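(* Let $\varepsilon=\frac13-\frac1{48}$. Define $\theta_1=0$, $\theta_2=\frac{2\pi}{3}$, $\theta_3=\frac{4\pi}{3}$. Let $\theta_4$ be such that $(\cos\theta_4,\sin\theta_4)=\left(\frac13,\frac{\sqrt8}{3}\right)$, and let $\theta_5=\theta_4+\frac{2\pi}{3}$, $\theta_6=\theta_4+\frac{4\pi}{3}$. Let $\theta_7$ be such that $(\cos\theta_7,\sin\theta_7)=\left(\frac13,-\frac{\sqrt8}{3}\right)$, and let $\theta_8=\theta_7+\frac{2\pi}{3}$, $\theta_9=\theta_7+\frac{4\pi}{3}$. Then $\bigcup_{j=1}^{9}R_{\theta_j}E_{\varepsilon}=\mathbb{R}^2$.
   Context: For real $x$, $\|x\|$ denotes the distance from $x$ to the nearest integer. For $\varepsilon>0$, $E_{\varepsilon}=\{(x,y)\in\mathbb{R}^2:\|x\|\le\varepsilon\}$. $R_{\theta}$ denotes the counterclockwise rotation of the plane $\mathbb{R}^2$ by angle $\theta$ around the origin. *)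

theory Defs
  imports Complex_Main
begin

definition dist_nearest_int :: "real \<Rightarrow> real" where
  "dist_nearest_int x = \<bar>x - of_int (round x)\<bar>"

definition strips :: "real \<Rightarrow> (real \<times> real) set" where
  "strips \<epsilon> = {(x, y). dist_nearest_int x \<le> \<epsilon>}"

definition rotation :: "real \<Rightarrow> real \<times> real \<Rightarrow> real \<times> real" where
  "rotation \<theta> = (\<lambda>(x, y). (x * cos \<theta> - y * sin \<theta>, x * sin \<theta> + y * cos \<theta>))"

end

theory Submission
  imports Defs
begin

text \<open>
  A point lies in the rotated strips iff its coordinate \<open>x cos \<theta> + y sin \<theta>\<close> is within \<open>\<epsilon> = 5/16\<close> of an
  integer. The three coordinates along directions at mutual angle \<open>2\<pi>/3\<close> sum to zero; if all three are
  farther than \<open>5/16\<close> from the integers, then up to sign each has fractional part in the short interval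
  \<open>(5/16, 3/8)\<close>. So for an uncovered point the coordinates \<open>a, b, c\<close> along \<open>\<theta>\<^sub>1, \<theta>\<^sub>4, \<theta>\<^sub>7\<close> satisfy
  \<open>\<parallel>3b\<parallel> < 1/8\<close>, \<open>\<parallel>3c\<parallel> < 1/8\<close> and \<open>\<parallel>2a\<parallel> > 1/4\<close>. But the three directions are related by
  \<open>3 (b + c) = 2 a\<close>, a contradiction.
\<close>

lemma dist_nearest_int_le: "dist_nearest_int x \<le> \<bar>x - of_int n\<bar>"
  unfolding dist_nearest_int_def by (rule round_diff_minimal)

lemma far_from_ints_floor:
  assumes "e < dist_nearest_int x"
  shows "of_int \<lfloor>x\<rfloor> + e < x" "x < of_int \<lfloor>x\<rfloor> + 1 - e"
  using assms dist_nearest_int_le[of x "\<lfloor>x\<rfloor>"] dist_nearest_int_le[of x "\<lfloor>x\<rfloor> + 1"]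
    floor_correct[of x] by auto

lemma rotated_strips_iff:
  "(x, y) \<in> rotation t ` strips e \<longleftrightarrow> dist_nearest_int (x * cos t + y * sin t) \<le> e"
proof
  assume "(x, y) \<in> rotation t ` strips e"
  then obtain u v where uv: "x = u * cos t - v * sin t" "y = u * sin t + v * cos t"
    "dist_nearest_int u \<le> e"
    by (auto simp: rotation_def strips_def)
  \<comment> \<open>Keeping the factor \<open>(sin t)\<^sup>2 + (cos t)\<^sup>2\<close> unevaluated
    makes this a polynomial identity.\<close>
  have "x * cos t + y * sin t = u * ((sin t)\<^sup>2 + (cos t)\<^sup>2)"
    by (simp only: uv) algebra
  then show "dist_nearest_int (x * cos t + y * sin t) \<le> e"
    using uv by simp
next
  assume *: "dist_nearest_int (x * cos t + y * sin t) \<le> e"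
  \<comment> \<open>\<open>(?u, ?v)\<close> is \<open>(x, y)\<close> rotated back by the angle
    \<open>t\<close>.\<close>
  let ?u = "x * cos t + y * sin t" and ?v = "y * cos t - x * sin t"
  have "?u * cos t - ?v * sin t = x * ((sin t)\<^sup>2 + (cos t)\<^sup>2)"
    "?u * sin t + ?v * cos t = y * ((sin t)\<^sup>2 + (cos t)\<^sup>2)"
    by algebra+
  then have "rotation t (?u, ?v) = (x, y)"
    by (simp add: rotation_def)
  moreover have "(?u, ?v) \<in> strips e"
    using * by (simp add: strips_def)
  ultimately show "(x, y) \<in> rotation t ` strips e"
    by (metis image_eqI)
qed

lemma cos_sin_thirds_sum:
  fixes t :: real
  shows "cos t + cos (t + 2 * pi / 3) + cos (t + 4 * pi / 3) = 0"
    and "sin t + sin (t + 2 * pi / 3) + sin (t + 4 * pi / 3) = 0"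
proof -
  have "4 * pi / 3 = pi / 3 + pi"
    by simp
  then have "cos (4 * pi / 3) = - (1 / 2)" "sin (4 * pi / 3) = - (sqrt 3 / 2)"
    by (simp_all only: cos_periodic_pi sin_periodic_pi cos_60 sin_60)
  then show "cos t + cos (t + 2 * pi / 3) + cos (t + 4 * pi / 3) = 0"
    and "sin t + sin (t + 2 * pi / 3) + sin (t + 4 * pi / 3) = 0"
    by (simp_all add: cos_add sin_add cos_120 sin_120)
qed

text \<open>The three fractional parts lie strictly between 5/16 and 11/16 and have an integer sum,
  which must be 1 or 2; fixing the sum confines each part to a shorter interval.\<close>

lemma far_triple:
  assumes "a + b + c = 0"
    and far: "5 / 16 < dist_nearest_int a" "5 / 16 < dist_nearest_int b" "5 / 16 < dist_nearest_int c"
  shows "\<exists>k::int. \<bar>3 * a - of_int k\<bar> < 1 / 8"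
    and "\<exists>j::int. of_int j + 1 / 4 < 2 * a \<and> 2 * a < of_int j + 3 / 4"
proof -
  note bounds = far_from_ints_floor[OF far(1)] far_from_ints_floor[OF far(2)]
    far_from_ints_floor[OF far(3)]
  \<comment> \<open>As \<open>a + b + c = 0\<close>, \<open>s\<close> is the sum of the fractional
    parts.\<close>
  define s where "s = - (\<lfloor>a\<rfloor> + \<lfloor>b\<rfloor> + \<lfloor>c\<rfloor>)"
  have s: "real_of_int s = - (of_int \<lfloor>a\<rfloor> + of_int \<lfloor>b\<rfloor> + of_int \<lfloor>c\<rfloor>)"
    by (simp add: s_def)
  have "0 < real_of_int s" "real_of_int s < 3"
    using s bounds assms(1) by linarith+
  then have "s = 1 \<or> s = 2"
    by linarith
  then have "(\<exists>k::int. \<bar>3 * a - of_int k\<bar> < 1 / 8) \<and>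
      (\<exists>j::int. of_int j + 1 / 4 < 2 * a \<and> 2 * a < of_int j + 3 / 4)"
  proof
    assume "s = 1"
    \<comment> \<open>The other two parts exceed 5/16, and 1 - 2 * 5/16 = 3/8.\<close>
    then have "a < of_int \<lfloor>a\<rfloor> + 3 / 8"
      using s bounds assms(1) by simp
    then have "\<bar>3 * a - of_int (3 * \<lfloor>a\<rfloor> + 1)\<bar> < 1 / 8"
      "of_int (2 * \<lfloor>a\<rfloor>) + 1 / 4 < 2 * a \<and> 2 * a < of_int (2 * \<lfloor>a\<rfloor>) + 3 / 4"
      using bounds(1) by (simp_all only: abs_less_iff) simp_all
    then show ?thesis
      by blast
  next
    assume "s = 2"
    \<comment> \<open>The other two parts are below 11/16, and 2 - 2 * 11/16 = 5/8.\<close>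
    then have "of_int \<lfloor>a\<rfloor> + 5 / 8 < a"
      using s bounds assms(1) by simp
    then have "\<bar>3 * a - of_int (3 * \<lfloor>a\<rfloor> + 2)\<bar> < 1 / 8"
      "of_int (2 * \<lfloor>a\<rfloor> + 1) + 1 / 4 < 2 * a \<and> 2 * a < of_int (2 * \<lfloor>a\<rfloor> + 1) + 3 / 4"
      using bounds(2) by (simp_all only: abs_less_iff) simp_all
    then show ?thesis
      by blast
  qed
  then show "\<exists>k::int. \<bar>3 * a - of_int k\<bar> < 1 / 8"
    and "\<exists>j::int. of_int j + 1 / 4 < 2 * a \<and> 2 * a < of_int j + 3 / 4"
    by blast+
qed

theorem theorem3p1:
  fixes \<epsilon> :: real and \<theta> :: "nat \<Rightarrow> real"
  assumes "\<epsilon> = 1 / 3 - 1 / 48"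
    and "\<theta> 1 = 0" and "\<theta> 2 = 2 * pi / 3" and "\<theta> 3 = 4 * pi / 3"
    and "(cos (\<theta> 4), sin (\<theta> 4)) = (1 / 3, sqrt 8 / 3)"
    and "\<theta> 5 = \<theta> 4 + 2 * pi / 3" and "\<theta> 6 = \<theta> 4 + 4 * pi / 3"
    and "(cos (\<theta> 7), sin (\<theta> 7)) = (1 / 3, - (sqrt 8 / 3))"
    and "\<theta> 8 = \<theta> 7 + 2 * pi / 3" and "\<theta> 9 = \<theta> 7 + 4 * pi / 3"
  shows "(\<Union>j\<in>{1..9}. rotation (\<theta> j) ` strips \<epsilon>) = UNIV"
proof -
  have "(x, y) \<in> (\<Union>j\<in>{1..9}. rotation (\<theta> j) ` strips \<epsilon>)" for x y
  proof (rule ccontr)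
    define L where "L t = x * cos t + y * sin t" for t
    assume "(x, y) \<notin> (\<Union>j\<in>{1..9}. rotation (\<theta> j) ` strips \<epsilon>)"
    then have far: "5 / 16 < dist_nearest_int (L (\<theta> j))" if "j \<in> {1..9}" for j
      using that assms(1) by (auto simp: rotated_strips_iff L_def not_le)
    have "L t + L (t + 2 * pi / 3) + L (t + 4 * pi / 3) =
        x * (cos t + cos (t + 2 * pi / 3) + cos (t + 4 * pi / 3)) +
        y * (sin t + sin (t + 2 * pi / 3) + sin (t + 4 * pi / 3))" for t
      by (simp add: L_def algebra_simps)
    then have sum0: "L t + L (t + 2 * pi / 3) + L (t + 4 * pi / 3) = 0" for t
      by (simp only: cos_sin_thirds_sum mult_zero_right add_0)
    have "L (\<theta> 1) + L (\<theta> 2) + L (\<theta> 3) = 0"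
      using sum0[of 0] by (simp only: assms(2-4) add_0)
    from far_triple(2)[OF this] far obtain j :: int
      where j: "of_int j + 1 / 4 < 2 * L (\<theta> 1)" "2 * L (\<theta> 1) < of_int j + 3 / 4"
      by auto
    have "L (\<theta> 4) + L (\<theta> 5) + L (\<theta> 6) = 0"
      using sum0[of "\<theta> 4"] assms(6,7) by simp
    from far_triple(1)[OF this] far obtain k :: int where k: "\<bar>3 * L (\<theta> 4) - of_int k\<bar> < 1 / 8"
      by auto
    have "L (\<theta> 7) + L (\<theta> 8) + L (\<theta> 9) = 0"
      using sum0[of "\<theta> 7"] assms(9,10) by simp
    from far_triple(1)[OF this] far obtain l :: int where l: "\<bar>3 * L (\<theta> 7) - of_int l\<bar> < 1 / 8"
      by auto
    \<comment> \<open>The sine terms cancel, the cosines add up to 2/3, and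
      \<open>L (\<theta> 1)\<close> is \<open>x\<close>.\<close>
    have "3 * (L (\<theta> 4) + L (\<theta> 7)) = 2 * L (\<theta> 1)"
      using assms(5,8) by (simp only: L_def assms(2) prod.inject) (simp add: field_simps)
    \<comment> \<open>\<open>k + l\<close> is less than 1/8 + 1/8 = 1/4 away from
      \<open>2 * L (\<theta> 1)\<close>, which is more than 1/4 away from both \<open>j\<close> and
      \<open>j + 1\<close>. So an integer would lie strictly between consecutive integers.\<close>
    then have "real_of_int j < real_of_int k + real_of_int l"
      "real_of_int k + real_of_int l < real_of_int j + 1"
      using j abs_less_iff[THEN iffD1, OF k] abs_less_iff[THEN iffD1, OF l]
      by (simp_all only: distrib_left) argo+
    then have "j < k + l" "k + l < j + 1"
      by (simp_all only: of_int_less_iff[where 'a = real, symmetric] of_int_add of_int_1)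
    then show False
      by simp
  qed
  then show ?thesis
    by auto
qed

end
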